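(* For every integer $c\ge1$ there exists a constant $\alpha>0$ and infinitely many integers $N$ such that for each of them there is a 2D string $S\in\Sigma^{N\times N}$ and a 2D SLP $\mathcal G$ with $g$ nonterminals deriving $S$, such that every 2D SLP deriving $S$ either has depth at least $c\log N$ or has at least $\alpha\cdot g\cdot N/\log^{3}N$ nonterminals.
   Context: $\Sigma$ is a fixed finite alphabet (containing at least the symbols $0,1,\$$); logarithms are base 2. A 2D string of size $n\times m$ is an $n\times m$ array over $\Sigma$. A 2D SLP is a triple $(\mathcal V,\mathcal S,\rho)$ where $\mathcal V$ is a finite set of nonterminals each with a dimension (height, width), $\mathcal S\in\mathcal V$ is the start, and each production $\rho(X)$ is either a character $\sigma\in\Sigma$ ($X$ of size $1\times 1$), a horizontal concatenation $Y\oplus_{\mathrm h}Z$ of two nonterminals of the same height as $X$ (placing $Z$ to the right of $Y$; widths add), or a vertical concatenation $Y\oplus_{\mathrm v}Z$ of two nonterminals of the same width as $X$ (placing $Z$ below $Y$; heights add), with the occurrence relation acyclic. It derives the 2D string obtained by recursively expanding $\mathcal S$. Its depth is the depth of its derivation tree (rooted at $\mathcal S$, each node labeled $X$ having as children the symbols of $\rho(X)$). *)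

theory Defs
  imports Complex_Main
begin

definition is_2d :: "'a list list \<Rightarrow> nat \<Rightarrow> nat \<Rightarrow> bool" where
  "is_2d M n m \<longleftrightarrow> length M = n \<and> (\<forall>r\<in>set M. length r = m)"

datatype 'a rhs = Chr 'a | HCat nat nat | VCat nat nat

record 'a slp2 =
  nts :: "nat set"
  start :: nat
  rules :: "nat \<Rightarrow> 'a rhs"

fun rhs_syms :: "'a rhs \<Rightarrow> nat set" where
  "rhs_syms (Chr _) = {}"
| "rhs_syms (HCat Y Z) = {Y, Z}"
| "rhs_syms (VCat Y Z) = {Y, Z}"

definition occ :: "'a slp2 \<Rightarrow> (nat \<times> nat) set" where
  "occ G = {(X, Y). X \<in> nts G \<and> Y \<in> rhs_syms (rules G X)}"

inductive derives :: "'a slp2 \<Rightarrow> nat \<Rightarrow> 'a list list \<Rightarrow> bool" for G where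
  chr: "rules G X = Chr a \<Longrightarrow> derives G X [[a]]"
| hcat: "rules G X = HCat Y Z \<Longrightarrow> derives G Y A \<Longrightarrow> derives G Z B \<Longrightarrow>
         length A = length B \<Longrightarrow> derives G X (map2 (@) A B)"
| vcat: "rules G X = VCat Y Z \<Longrightarrow> derives G Y A \<Longrightarrow> derives G Z B \<Longrightarrow>
         length (hd A) = length (hd B) \<Longrightarrow> derives G X (A @ B)"

inductive slp_depth :: "'a slp2 \<Rightarrow> nat \<Rightarrow> nat \<Rightarrow> bool" for G where
  chr: "rules G X = Chr a \<Longrightarrow> slp_depth G X 1"
| hcat: "rules G X = HCat Y Z \<Longrightarrow> slp_depth G Y d1 \<Longrightarrow> slp_depth G Z d2 \<Longrightarrow>
         slp_depth G X (Suc (max d1 d2))"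
| vcat: "rules G X = VCat Y Z \<Longrightarrow> slp_depth G Y d1 \<Longrightarrow> slp_depth G Z d2 \<Longrightarrow>
         slp_depth G X (Suc (max d1 d2))"

text \<open>Well-formed 2D SLP: finite nonterminal set containing the start, closed under
  the productions, acyclic occurrence relation, and every nonterminal has a consistent
  dimension (i.e. expands to some 2D string).\<close>
definition is_slp2 :: "'a slp2 \<Rightarrow> bool" where
  "is_slp2 G \<longleftrightarrow> finite (nts G) \<and> start G \<in> nts G
     \<and> (\<forall>X\<in>nts G. rhs_syms (rules G X) \<subseteq> nts G)
     \<and> acyclic (occ G)
     \<and> (\<forall>X\<in>nts G. \<exists>M. derives G X M)"

definition slp_derives :: "'a slp2 \<Rightarrow> 'a list list \<Rightarrow> bool" where
  "slp_derives G S \<longleftrightarrow> is_slp2 G \<and> derives G (start G) S"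

definition depth :: "'a slp2 \<Rightarrow> nat" where
  "depth G = (THE d. slp_depth G (start G) d)"

end

(* The string consists of m >= 2 c log N nested layers, each a horizontal band along the top and a
   vertical band along the left. A band stacks K copies of a binary counter, the j-th copy shifted
   by j, so it has O(log N) rules by repeated doubling, but any line crossing it spells K different
   counter values, with marks in between. Hence the child of a node cut along such a line has a first
   row or column with about K log N distinct windows of length O(log N). Projecting the SLP to first
   rows or columns gives a one-dimensional SLP, in which each nonterminal accounts for O(log N)
   windows; so at least K/4 nonterminals are needed, and K is about N / log^2 N. A derivation of small
   depth must cross a band: every other cut on the way to the core removes at most two layers. *)
theory Submission
  imports Defs "HOL-Library.Infinite_Set"
begin

section \<open>Derivations and depth\<close>

lemma derives_is_2d:
  assumes "derives G X A"
  shows "\<exists>h w. is_2d A h w \<and> h > 0 \<and> w > 0"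
  using assms
proof induction
  case (chr X a)
  show ?case by (auto simp: is_2d_def)
next
  case (hcat X Y Z A B)
  then obtain h a b where "is_2d A h a" "is_2d B h b" "h > 0" "a > 0"
    unfolding is_2d_def by metis
  then have "is_2d (map2 (@) A B) h (a + b)"
    by (auto simp: is_2d_def elim!: in_set_zipE)
  with \<open>h > 0\<close> \<open>a > 0\<close> show ?case by (metis add_pos_nonneg zero_le)
next
  case (vcat X Y Z A B)
  then obtain h h' a b where *: "is_2d A h a" "is_2d B h' b" "h > 0" "a > 0" "h' > 0"
    by metis
  then have "length (hd A) = a" "length (hd B) = b"
    unfolding is_2d_def by (metis hd_in_set length_greater_0_conv)+
  with * vcat.hyps have "is_2d (A @ B) (h + h') a"
    unfolding is_2d_def by auto
  with * show ?case by (metis add_pos_nonneg zero_le)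
qed

lemma derives_rectangular:
  assumes "derives G X A"
  shows "A \<noteq> []" "hd A \<noteq> []" "r \<in> set A \<Longrightarrow> length r = length (hd A)"
proof -
  obtain h w where *: "length A = h" "\<And>r. r \<in> set A \<Longrightarrow> length r = w" "h > 0" "w > 0"
    using derives_is_2d[OF assms] unfolding is_2d_def by metis
  then show A: "A \<noteq> []" by auto
  from *(2)[OF hd_in_set[OF A]] *(4) show "hd A \<noteq> []" by auto
  show "length r = length (hd A)" if "r \<in> set A"
    using *(2)[OF that] *(2)[OF hd_in_set[OF A]] by simp
qed

lemma derives_nth_length:
  assumes "derives G X A" "i < length A"
  shows "length (A ! i) = length (hd A)"
  using derives_rectangular(3)[OF assms(1)] assms(2) by simp

lemma derives_unique: "derives G X A \<Longrightarrow> derives G X B \<Longrightarrow> A = B"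
proof (induction arbitrary: B rule: derives.induct)
  case (chr X a)
  from chr(2,1) show ?case by cases auto
next
  case (hcat X Y Z A1 A2)
  from hcat.prems obtain B1 B2 where "B = map2 (@) B1 B2" "derives G Y B1" "derives G Z B2"
    by cases (use hcat.hyps(1) in auto)
  with hcat.IH show ?case by metis
next
  case (vcat X Y Z A1 A2)
  from vcat.prems obtain B1 B2 where "B = B1 @ B2" "derives G Y B1" "derives G Z B2"
    by cases (use vcat.hyps(1) in auto)
  with vcat.IH show ?case by metis
qed

lemma slp_depth_unique: "slp_depth G X d \<Longrightarrow> slp_depth G X d' \<Longrightarrow> d = d'"
proof (induction arbitrary: d' rule: slp_depth.induct)
  case (chr X a)
  from chr(2,1) show ?case by cases auto
next
  case (hcat X Y Z d1 d2)
  from hcat.prems obtain e1 e2 where "d' = Suc (max e1 e2)" "slp_depth G Y e1" "slp_depth G Z e2"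
    by cases (use hcat.hyps(1) in auto)
  with hcat.IH show ?case by metis
next
  case (vcat X Y Z d1 d2)
  from vcat.prems obtain e1 e2 where "d' = Suc (max e1 e2)" "slp_depth G Y e1" "slp_depth G Z e2"
    by cases (use vcat.hyps(1) in auto)
  with vcat.IH show ?case by metis
qed

lemma derives_slp_depth: "derives G X A \<Longrightarrow> \<exists>d. slp_depth G X d"
  by (induction rule: derives.induct) (blast intro: slp_depth.intros)+

lemma slp_depth_depth:
  assumes "slp_derives G S"
  shows "slp_depth G (start G) (depth G)"
proof -
  obtain d where "slp_depth G (start G) d"
    using assms derives_slp_depth unfolding slp_derives_def by blast
  then show ?thesis
    unfolding depth_def using slp_depth_unique by (metis theI)
qed

text \<open>Only the rules reachable from a nonterminal matter for what it derives; \<open>V\<close>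
  is any set closed under the productions. Taking \<open>V = UNIV\<close> changes \<open>nts\<close>
  and \<open>start\<close> freely, taking \<open>V = {..<p}\<close> allows a rule to be added at
  \<open>p\<close>.\<close>

lemma derives_cong:
  assumes "derives G X A" "X \<in> V"
    and "\<And>Y. Y \<in> V \<Longrightarrow> rules G' Y = rules G Y \<and> rhs_syms (rules G Y) \<subseteq> V"
  shows "derives G' X A"
  using assms(1,2)
proof induction
  case (chr X a)
  then show ?case using assms(3)[of X] by (auto intro: derives.chr)
next
  case (hcat X Y Z A B)
  then show ?case using assms(3)[of X] by (auto intro: derives.hcat)
next
  case (vcat X Y Z A B)
  then show ?case using assms(3)[of X] by (auto intro: derives.vcat)
qed

section \<open>Distinct windows in the first row or column\<close>

text \<open>Here \<open>F\<close> stands for the first row (\<open>hd\<close>) or the first column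
  (\<open>map hd\<close>). Under each concatenation such an \<open>F\<close> either ignores the
  second factor or appends its image, so it projects the 2D SLP to a one-dimensional one. Every
  window is then charged to a nonterminal whose two factors it straddles, with at most
  \<open>L\<close> offsets for each.\<close>

lemma card_windows_le:
  fixes F :: "'a list list \<Rightarrow> 'a list"
  assumes slp: "is_slp2 G" and "X \<in> nts G" and "derives G X A"
    and chr: "\<And>a. length (F [[a]]) = 1"
    and hcat: "\<And>Y A Z B. derives G Y A \<Longrightarrow> derives G Z B \<Longrightarrow> length A = length B \<Longrightarrow>
      F (map2 (@) A B) \<in> {F A, F A @ F B}"
    and vcat: "\<And>Y A Z B. derives G Y A \<Longrightarrow> derives G Z B \<Longrightarrow> length (hd A) = length (hd B) \<Longrightarrow>
      F (A @ B) \<in> {F A, F A @ F B}"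
    and "L \<ge> 2"
  shows "card ((\<lambda>i. take L (drop i (F A))) ` {i. i + L \<le> length (F A)}) \<le> card (nts G) * L"
proof -
  have closed: "Y \<in> nts G" if "X \<in> nts G" "Y \<in> rhs_syms (rules G X)" for X Y
    using slp that unfolding is_slp2_def by blast
  have fin: "finite (nts G)"
    using slp unfolding is_slp2_def by blast
  \<comment> \<open>Derived arrays are unique, so \<open>THE\<close> selects the right one; the
    value is meaningful only for an \<open>X\<close> that derives something.\<close>
  define str where "str X = F (THE M. derives G X M)" for X
  have str: "str X = F M" if "derives G X M" for X M
  proof -
    have "(THE M. derives G X M) = M"
      by (rule the_equality) (use that derives_unique[OF _ that] in blast)+
    then show ?thesis by (simp add: str_def)
  qed
  define split where "split X = (case rules G X of Chr _ \<Rightarrow> 0 | HCat Y Z \<Rightarrow> length (str Y)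
    | VCat Y Z \<Rightarrow> length (str Y))" for X
  \<comment> \<open>When the projection keeps only the first factor, \<open>split X\<close> is the
    full length. Windows running past an end merely enlarge \<open>Win\<close>, which is harmless
    for an upper bound.\<close>
  define Win where "Win = (\<lambda>(X, d). take L (drop (split X - d) (str X))) ` (nts G \<times> {..<L})"
  text \<open>A window of a concatenation lies in one of the two factors, or it straddles the splitting
    point, at one of fewer than \<^term>\<open>L\<close> positions.\<close>
  have cat: "take L (drop i (s @ s')) \<in> Win"
    if "X \<in> nts G" "str X = s @ s'" "split X = length s" "i + L \<le> length (s @ s')"
      and l: "\<And>i. i + L \<le> length s \<Longrightarrow> take L (drop i s) \<in> Win"
      and r: "\<And>i. i + L \<le> length s' \<Longrightarrow> take L (drop i s') \<in> Win"
    for X s s' i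
  proof -
    consider "i + L \<le> length s" | "i \<ge> length s" | "i < length s" "length s < i + L"
      by linarith
    then show ?thesis
    proof cases
      case 1
      then show ?thesis using l[of i] by simp
    next
      case 2
      then show ?thesis using r[of "i - length s"] that(4) by simp
    next
      case 3
      with that(1-3) show ?thesis
        unfolding Win_def by (intro image_eqI[where x = "(X, length s - i)"]) auto
    qed
  qed
  have main: "take L (drop i (F A)) \<in> Win"
    if "derives G X A" "X \<in> nts G" "i + L \<le> length (F A)" for X A i
    using that
  proof (induction arbitrary: i rule: derives.induct)
    case (chr X a)
    \<comment> \<open>A single character has no window of length at least 2.\<close>
    then show ?case using assms(4)[of a] \<open>L \<ge> 2\<close> by simp
  next
    case (hcat X Y Z A B)
    have mem: "Y \<in> nts G" "Z \<in> nts G"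
      using closed[OF hcat.prems(1)] hcat.hyps(1) by auto
    have "str X = F (map2 (@) A B)"
      by (rule str) (rule derives.hcat[OF hcat.hyps])
    moreover have "split X = length (F A)"
      using hcat.hyps str[of Y A] by (simp add: split_def)
    moreover have "F (map2 (@) A B) = F A \<or> F (map2 (@) A B) = F A @ F B"
      using assms(5)[OF hcat.hyps(2-4)] by blast
    ultimately show ?case
      using hcat.IH(1)[OF mem(1)] hcat.prems cat[OF _ _ _ _ hcat.IH(1)[OF mem(1)] hcat.IH(2)[OF mem(2)]]
      by metis
  next
    case (vcat X Y Z A B)
    have mem: "Y \<in> nts G" "Z \<in> nts G"
      using closed[OF vcat.prems(1)] vcat.hyps(1) by auto
    have "str X = F (A @ B)"
      by (rule str) (rule derives.vcat[OF vcat.hyps])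
    moreover have "split X = length (F A)"
      using vcat.hyps str[of Y A] by (simp add: split_def)
    moreover have "F (A @ B) = F A \<or> F (A @ B) = F A @ F B"
      using assms(6)[OF vcat.hyps(2-4)] by blast
    ultimately show ?case
      using vcat.IH(1)[OF mem(1)] vcat.prems cat[OF _ _ _ _ vcat.IH(1)[OF mem(1)] vcat.IH(2)[OF mem(2)]]
      by metis
  qed
  have "(\<lambda>i. take L (drop i (F A))) ` {i. i + L \<le> length (F A)} \<subseteq> Win"
    using main[OF assms(3,2)] by auto
  moreover have "finite Win"
    unfolding Win_def using fin by simp
  moreover have "card Win \<le> card (nts G \<times> {..<L})"
    unfolding Win_def using fin by (intro card_image_le) simp
  ultimately show ?thesis
    using card_mono[of Win] by (metis card_cartesian_product card_lessThan order_trans)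
qed

lemma card_windows_first_column:
  assumes "is_slp2 G" "X \<in> nts G" "derives G X A" "L \<ge> 2"
  shows "card ((\<lambda>i. take L (drop i (map hd A))) ` {i. i + L \<le> length A}) \<le> card (nts G) * L"
proof -
  have "map hd (map2 (@) A B) = map hd A"
    if "derives G Y A" "derives G Z B" "length A = length B" for Y Z A B
  proof (rule nth_equalityI)
    fix i assume "i < length (map hd (map2 (@) A B))"
    then have i: "i < length A" "i < length B" by auto
    then have "A ! i \<noteq> []"
      using derives_nth_length[OF that(1), of i] derives_rectangular(2)[OF that(1)] by force
    with i show "map hd (map2 (@) A B) ! i = map hd A ! i" by simp
  qed (use that in simp)
  then show ?thesis
    using card_windows_le[where F = "map hd", OF assms(1-3) _ _ _ assms(4)] by simp
qed

lemma card_windows_first_row: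
  assumes "is_slp2 G" "X \<in> nts G" "derives G X A" "L \<ge> 2"
  shows "card ((\<lambda>i. take L (drop i (hd A))) ` {i. i + L \<le> length (hd A)}) \<le> card (nts G) * L"
proof (rule card_windows_le[where F = hd, OF assms(1-3) _ _ _ assms(4)])
  fix Y A Z B
  assume "derives G Y A" "derives G Z B" "length A = length B"
  then show "hd (map2 (@) A B) \<in> {hd A, hd A @ hd B}"
    using derives_rectangular(1)[of G Y A] derives_rectangular(1)[of G Z B]
    by (cases A; cases B) auto
next
  fix Y A Z B
  assume "derives G Y A"
  then show "hd (A @ B) \<in> {hd A, hd A @ hd B}"
    using derives_rectangular(1)[of G Y A] by auto
qed simp

section \<open>Counting the rules of a straight-line program\<close>

definition mat :: "nat \<Rightarrow> nat \<Rightarrow> (nat \<Rightarrow> nat \<Rightarrow> 'a) \<Rightarrow> 'a list list" where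
  "mat h w f = map (\<lambda>i. map (f i) [0..<w]) [0..<h]"

lemma length_mat [simp]: "length (mat h w f) = h"
  by (simp add: mat_def)

lemma nth_mat [simp]: "i < h \<Longrightarrow> mat h w f ! i = map (f i) [0..<w]"
  by (simp add: mat_def)

lemma length_hd_mat [simp]: "h > 0 \<Longrightarrow> length (hd (mat h w f)) = w"
  by (simp add: mat_def hd_map)

lemma mat_cong: "(\<And>i j. i < h \<Longrightarrow> j < w \<Longrightarrow> f i j = g i j) \<Longrightarrow> mat h w f = mat h w g"
  by (auto simp: mat_def)

lemma is_2d_mat: "is_2d (mat h w f) h w"
  by (auto simp: is_2d_def mat_def)

lemma hcat_mat:
  "map2 (@) (mat h a f) (mat h b g) = mat h (a + b) (\<lambda>i j. if j < a then f i j else g i (j - a))"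
  by (rule nth_equalityI) (auto intro!: nth_equalityI simp: nth_append)

lemma vcat_mat: "mat a w f @ mat b w g = mat (a + b) w (\<lambda>i j. if i < a then f i j else g (i - a) j)"
  by (rule nth_equalityI) (auto intro!: nth_equalityI simp: nth_append)

text \<open>All arrays in the set are built together with at most \<open>n\<close> rules, so
  intermediate results are shared. The order of construction replaces named nonterminals, which
  makes acyclicity automatic and lets costs be bounded by induction.\<close>

inductive gens :: "nat \<Rightarrow> 'a list list set \<Rightarrow> bool" where
  empty: "gens 0 {}"
| weaken: "gens n F \<Longrightarrow> F' \<subseteq> F \<Longrightarrow> n \<le> n' \<Longrightarrow> gens n' F'"
| chr: "gens n F \<Longrightarrow> gens (Suc n) (insert [[a]] F)"
| hcat: "gens n F \<Longrightarrow> A \<in> F \<Longrightarrow> B \<in> F \<Longrightarrow> length A = length B \<Longrightarrow>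
    gens (Suc n) (insert (map2 (@) A B) F)"
| vcat: "gens n F \<Longrightarrow> A \<in> F \<Longrightarrow> B \<in> F \<Longrightarrow> length (hd A) = length (hd B) \<Longrightarrow>
    gens (Suc n) (insert (A @ B) F)"

text \<open>Nonterminals are numbered in order of creation. The quantifier over \<open>G\<close>
  appears because \<open>derives\<close> takes a whole record although it consults only
  \<open>rules\<close>.\<close>

definition straight_line :: "(nat \<Rightarrow> 'a rhs) \<Rightarrow> nat \<Rightarrow> 'a list list set \<Rightarrow> bool" where
  "straight_line \<rho> p F \<longleftrightarrow> (\<forall>k<p. rhs_syms (\<rho> k) \<subseteq> {..<k}) \<and>
    (\<forall>G. rules G = \<rho> \<longrightarrow> (\<forall>k<p. \<exists>M. derives G k M) \<and> (\<forall>A\<in>F. \<exists>k<p. derives G k A))"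

text \<open>The premise \<open>M\<close> isolates what differs between the three kinds of rule. Old
  derivations survive because they only visit indices below \<open>p\<close>.\<close>

lemma straight_line_extend:
  assumes sl: "straight_line \<rho> p F" and "rhs_syms r \<subseteq> {..<p}"
    and M: "\<And>G G'. rules G = \<rho> \<Longrightarrow> (\<And>k A. k < p \<Longrightarrow> derives G k A \<Longrightarrow> derives G' k A) \<Longrightarrow>
      rules G' p = r \<Longrightarrow> derives G' p M"
  shows "straight_line (\<rho>(p := r)) (Suc p) (insert M F)"
  unfolding straight_line_def
proof (intro conjI allI impI)
  fix k assume "k < Suc p"
  then show "rhs_syms ((\<rho>(p := r)) k) \<subseteq> {..<k}"
    using sl assms(2) unfolding straight_line_def by (auto simp: less_Suc_eq)
next
  fix G' :: "'a slp2" assume G': "rules G' = \<rho>(p := r)"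
  define G where "G = G'\<lparr>rules := \<rho>\<rparr>"
  have G: "rules G = \<rho>" by (simp add: G_def)
  have old: "derives G' k A" if "k < p" "derives G k A" for k A
  proof (rule derives_cong[OF that(2), of "{..<p}"])
    fix Y assume "Y \<in> {..<p}"
    then show "rules G' Y = rules G Y \<and> rhs_syms (rules G Y) \<subseteq> {..<p}"
      using sl G G' unfolding straight_line_def by fastforce
  qed (use that in simp)
  have new: "derives G' p M"
    by (rule M[OF G]) (use old G' in auto)
  show "\<exists>M. derives G' k M" if "k < Suc p" for k
    using that sl G new old unfolding straight_line_def less_Suc_eq by blast
  show "\<forall>A\<in>insert M F. \<exists>k<Suc p. derives G' k A"
    using sl G new old unfolding straight_line_def less_Suc_eq by blast
qed

lemma gens_straight_line:
  assumes "gens n F"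
  shows "\<exists>\<rho> p. p \<le> n \<and> straight_line \<rho> p F"
  using assms
proof induction
  case empty
  then show ?case by (auto simp: straight_line_def)
next
  case (weaken n F F' n')
  then obtain \<rho> p where "p \<le> n" "straight_line \<rho> p F"
    by blast
  with weaken.hyps have "p \<le> n'" "straight_line \<rho> p F'"
    unfolding straight_line_def by auto
  then show ?case by blast
next
  case (chr n F a)
  then obtain \<rho> :: "nat \<Rightarrow> 'a rhs" and p where *: "p \<le> n" "straight_line \<rho> p F"
    by blast
  have "straight_line (\<rho>(p := Chr a)) (Suc p) (insert [[a]] F)"
    by (rule straight_line_extend[OF *(2)]) (auto intro: derives.chr)
  with *(1) show ?case by (intro exI[of _ "\<rho>(p := Chr a)"] exI[of _ "Suc p"]) (simp del: fun_upd_apply)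
next
  case (hcat n F A B)
  then obtain \<rho> :: "nat \<Rightarrow> 'a rhs" and p where *: "p \<le> n" "straight_line \<rho> p F"
    by blast
  \<comment> \<open>The record is a mere carrier of \<open>\<rho>\<close>; its \<open>nts\<close>
    and \<open>start\<close> are placeholders.\<close>
  obtain k l where kl: "k < p" "derives \<lparr>nts = {}, start = 0, rules = \<rho>\<rparr> k A"
    "l < p" "derives \<lparr>nts = {}, start = 0, rules = \<rho>\<rparr> l B"
    using *(2) hcat.hyps unfolding straight_line_def by (metis slp2.select_convs(3))
  have "derives G k A \<and> derives G l B" if "rules G = \<rho>" for G :: "'a slp2"
    using derives_cong[OF kl(2), of UNIV G] derives_cong[OF kl(4), of UNIV G] that by simp
  then have "straight_line (\<rho>(p := HCat k l)) (Suc p) (insert (map2 (@) A B) F)"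
    using kl(1,3) hcat.hyps(4) by (intro straight_line_extend[OF *(2)]) (simp, blast intro: derives.hcat)
  with *(1) show ?case by (intro exI[of _ "\<rho>(p := HCat k l)"] exI[of _ "Suc p"]) (simp del: fun_upd_apply)
next
  case (vcat n F A B)
  then obtain \<rho> :: "nat \<Rightarrow> 'a rhs" and p where *: "p \<le> n" "straight_line \<rho> p F"
    by blast
  obtain k l where kl: "k < p" "derives \<lparr>nts = {}, start = 0, rules = \<rho>\<rparr> k A"
    "l < p" "derives \<lparr>nts = {}, start = 0, rules = \<rho>\<rparr> l B"
    using *(2) vcat.hyps unfolding straight_line_def by (metis slp2.select_convs(3))
  have "derives G k A \<and> derives G l B" if "rules G = \<rho>" for G :: "'a slp2"
    using derives_cong[OF kl(2), of UNIV G] derives_cong[OF kl(4), of UNIV G] that by simp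
  then have "straight_line (\<rho>(p := VCat k l)) (Suc p) (insert (A @ B) F)"
    using kl(1,3) vcat.hyps(4) by (intro straight_line_extend[OF *(2)]) (simp, blast intro: derives.vcat)
  with *(1) show ?case by (intro exI[of _ "\<rho>(p := VCat k l)"] exI[of _ "Suc p"]) (simp del: fun_upd_apply)
qed

lemma gens_slp:
  assumes "gens n F" "S \<in> F"
  shows "\<exists>G. slp_derives G S \<and> card (nts G) \<le> n"
proof -
  obtain \<rho> :: "nat \<Rightarrow> 'a rhs" and p where *: "p \<le> n" "straight_line \<rho> p F"
    using gens_straight_line[OF assms(1)] by blast
  then obtain s where s: "s < p" "derives \<lparr>nts = {..<p}, start = 0, rules = \<rho>\<rparr> s S"
    using assms(2) unfolding straight_line_def by (metis slp2.select_convs(3))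
  define G where "G = \<lparr>nts = {..<p}, start = s, rules = \<rho>\<rparr>"
  have sub: "Y < X" if "X < p" "Y \<in> rhs_syms (\<rho> X)" for X Y
    using that *(2) unfolding straight_line_def by blast
  \<comment> \<open>Productions refer only to smaller numbers, so the numbering is a topological
    order.\<close>
  have "occ G \<subseteq> less_than\<inverse>"
    using sub by (auto simp: occ_def G_def)
  then have "acyclic (occ G)"
    by (meson acyclic_converse acyclic_subset wf_acyclic wf_less_than)
  moreover have "\<exists>M. derives G X M" if "X < p" for X
    using *(2) that unfolding straight_line_def by (simp add: G_def)
  moreover have "derives G s S"
    by (rule derives_cong[OF s(2), of UNIV]) (simp_all add: G_def)
  ultimately have "slp_derives G S"
    unfolding slp_derives_def is_slp2_def using s(1) sub by (fastforce simp: G_def)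
  then show ?thesis using *(1) by (intro exI[of _ G]) (simp add: G_def)
qed

section \<open>Transposition of straight-line programs\<close>

definition tr :: "'a list list \<Rightarrow> 'a list list" where
  "tr A = mat (length (hd A)) (length A) (\<lambda>i j. A ! j ! i)"

lemma tr_mat: "h > 0 \<Longrightarrow> tr (mat h w f) = mat w h (\<lambda>i j. f j i)"
  by (auto simp: tr_def intro!: mat_cong)

lemma gens_rectangular:
  assumes "gens n F" "A \<in> F"
  obtains h w f where "A = mat h w f" "h > 0" "w > 0"
proof -
  have "\<exists>h w f. A = mat h w f \<and> h > 0 \<and> w > 0"
    using assms
  proof (induction arbitrary: A)
    case (weaken n F F' n')
    then show ?case by blast
  next
    case (chr n F a)
    have "[[a]] = mat 1 1 (\<lambda>_ _. a)" by (simp add: mat_def)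
    with chr show ?case by fastforce
  next
    case (hcat n F A B C)
    from hcat.IH hcat.hyps obtain h a f h' b g where "A = mat h a f" "B = mat h' b g"
      "h > 0" "h' > 0" "a > 0" "b > 0" by metis
    with hcat.hyps(4) have "\<exists>h w f. map2 (@) A B = mat h w f \<and> h > 0 \<and> w > 0"
      by (simp add: hcat_mat) (metis add_gr_0)
    with hcat.IH hcat.prems show ?case by blast
  next
    case (vcat n F A B C)
    from vcat.IH vcat.hyps obtain h a f h' b g where "A = mat h a f" "B = mat h' b g"
      "h > 0" "h' > 0" "a > 0" "b > 0" by metis
    with vcat.hyps(4) have "\<exists>h w f. A @ B = mat h w f \<and> h > 0 \<and> w > 0"
      by (simp add: vcat_mat) (metis add_gr_0)
    with vcat.IH vcat.prems show ?case by blast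
  qed auto
  then show thesis using that by blast
qed

text \<open>Transposition exchanges the two kinds of concatenation and fixes single characters, so
  the number of rules is unchanged. It yields the vertical band from the horizontal one.\<close>

lemma gens_tr: "gens n F \<Longrightarrow> gens n (tr ` F)"
proof (induction rule: gens.induct)
  case empty
  then show ?case by (simp add: gens.empty)
next
  case (weaken n F F' n')
  then show ?case by (meson gens.weaken image_mono)
next
  case (chr n F a)
  have "tr [[a]] = [[a]]" by (simp add: tr_def mat_def)
  with gens.chr[OF chr.IH] show ?case by simp
next
  case (hcat n F A B)
  obtain h a f where A: "A = mat h a f" "h > 0" "a > 0"
    by (rule gens_rectangular[OF hcat.hyps(1,2)])
  obtain h' b g where B: "B = mat h' b g" "h' > 0" "b > 0"
    by (rule gens_rectangular[OF hcat.hyps(1,3)])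
  have "tr (map2 (@) A B) = tr A @ tr B"
    using A B hcat.hyps(4) by (simp add: hcat_mat vcat_mat tr_mat if_distrib)
  moreover have "length (hd (tr A)) = length (hd (tr B))"
    using A B hcat.hyps(4) by (simp add: tr_mat)
  ultimately show ?case
    using gens.vcat[OF hcat.IH, of "tr A" "tr B"] hcat.hyps(2,3) by simp
next
  case (vcat n F A B)
  obtain h a f where A: "A = mat h a f" "h > 0" "a > 0"
    by (rule gens_rectangular[OF vcat.hyps(1,2)])
  obtain h' b g where B: "B = mat h' b g" "h' > 0" "b > 0"
    by (rule gens_rectangular[OF vcat.hyps(1,3)])
  have "tr (A @ B) = map2 (@) (tr A) (tr B)"
    using A B vcat.hyps(4) by (simp add: hcat_mat vcat_mat tr_mat if_distrib)
  moreover have "length (tr A) = length (tr B)"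
    using A B vcat.hyps(4) by (simp add: tr_mat)
  ultimately show ?case
    using gens.hcat[OF vcat.IH, of "tr A" "tr B"] vcat.hyps(2,3) by simp
qed

section \<open>Combining programs and building constant blocks\<close>

lemma gens_Un: "gens n F \<Longrightarrow> gens n' F' \<Longrightarrow> gens (n + n') (F \<union> F')"
proof (rotate_tac, induction rule: gens.induct)
  case (weaken k E E' k')
  show ?case
    by (rule gens.weaken[OF weaken.IH[OF weaken.prems]]) (use weaken.hyps in auto)
qed (auto intro: gens.intros)

text \<open>The entry function \<open>e\<close> of the result may be one global formula that is
  checked on each part separately; this is how counters, bands and layers are all assembled.\<close>

lemma gens_hcat_mat:
  assumes "gens n F" "mat h a f \<in> F" "mat h b g \<in> F"
    and "\<And>i j. i < h \<Longrightarrow> j < a \<Longrightarrow> e i j = f i j" "\<And>i j. i < h \<Longrightarrow> j < b \<Longrightarrow> e i (a + j) = g i j"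
  shows "gens (Suc n) (insert (mat h (a + b) e) F)"
proof -
  have "map2 (@) (mat h a f) (mat h b g) = mat h (a + b) e"
    unfolding hcat_mat using assms(4) by (intro mat_cong) (auto simp flip: assms(5))
  then show ?thesis using gens.hcat[OF assms(1-3)] by simp
qed

lemma gens_vcat_mat:
  assumes "gens n F" "mat a w f \<in> F" "mat b w g \<in> F"
    and "\<And>i j. i < a \<Longrightarrow> j < w \<Longrightarrow> e i j = f i j" "\<And>i j. i < b \<Longrightarrow> j < w \<Longrightarrow> e (a + i) j = g i j"
  shows "gens (Suc n) (insert (mat (a + b) w e) F)"
proof -
  have pos: "a > 0" "b > 0"
    by (metis assms(1-3) gens_rectangular length_mat)+
  have "mat a w f @ mat b w g = mat (a + b) w e"
    unfolding vcat_mat using assms(4) by (intro mat_cong) (auto simp flip: assms(5))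
  then show ?thesis using gens.vcat[OF assms(1-3)] pos by simp
qed

text \<open>Halving the width costs two rules per binary digit: one doubles, the other adds a last
  column if the width is odd. The block of width 1 stays in the set for the latter.\<close>

lemma gens_const_row: "0 < w \<Longrightarrow> w < 2 ^ k \<Longrightarrow> gens (2 * k) {mat 1 w (\<lambda>_ _. z), mat 1 1 (\<lambda>_ _. z)}"
proof (induction k arbitrary: w)
  case (Suc k)
  let ?r = "\<lambda>w. mat 1 w (\<lambda>_ _. z)"
  consider "w = 1" | "w > 1" using Suc.prems by linarith
  then show ?case
  proof cases
    case 1
    have "gens 1 {?r 1}"
      using gens.chr[OF gens.empty, of z] by (simp add: mat_def)
    from gens.weaken[OF this, of "{?r w, ?r 1}" "2 * Suc k"] 1 show ?thesis by simp
  next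
    case 2
    define v where "v = w div 2"
    have v: "gens (2 * k) {?r v, ?r 1}"
      by (rule Suc.IH) (use 2 Suc.prems in \<open>simp_all add: v_def div_greater_zero_iff less_mult_imp_div_less\<close>)
    have vv: "gens (Suc (2 * k)) (insert (?r (v + v)) {?r v, ?r 1})"
      by (rule gens_hcat_mat[OF v]) simp_all
    have vv1: "gens (Suc (Suc (2 * k))) (insert (?r (v + v + 1)) (insert (?r (v + v)) {?r v, ?r 1}))"
      by (rule gens_hcat_mat[OF vv]) simp_all
    have "w = v + v \<or> w = v + v + 1" unfolding v_def by linarith
    then have "{?r w, ?r 1} \<subseteq> insert (?r (v + v + 1)) (insert (?r (v + v)) {?r v, ?r 1})"
      by blast
    from gens.weaken[OF vv1 this] show ?thesis by simp
  qed
qed simp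

lemma gens_const_column:
  assumes "gens n {mat 1 w (\<lambda>_ _. z)}" "0 < h" "h < 2 ^ k"
  shows "gens (n + 2 * k) {mat h w (\<lambda>_ _. z), mat 1 w (\<lambda>_ _. z)}"
  using assms(2,3)
proof (induction k arbitrary: h)
  case (Suc k)
  let ?r = "\<lambda>h. mat h w (\<lambda>_ _. z)"
  consider "h = 1" | "h > 1" using Suc.prems by linarith
  then show ?case
  proof cases
    case 1
    from gens.weaken[OF assms(1), of "{?r h, ?r 1}" "n + 2 * Suc k"] 1 show ?thesis by simp
  next
    case 2
    define v where "v = h div 2"
    have v: "gens (n + 2 * k) {?r v, ?r 1}"
      by (rule Suc.IH) (use 2 Suc.prems in \<open>simp_all add: v_def div_greater_zero_iff less_mult_imp_div_less\<close>)
    have vv: "gens (Suc (n + 2 * k)) (insert (?r (v + v)) {?r v, ?r 1})"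
      by (rule gens_vcat_mat[OF v]) simp_all
    have vv1: "gens (Suc (Suc (n + 2 * k))) (insert (?r (v + v + 1)) (insert (?r (v + v)) {?r v, ?r 1}))"
      by (rule gens_vcat_mat[OF vv]) simp_all
    have "h = v + v \<or> h = v + v + 1" unfolding v_def by linarith
    then have "{?r h, ?r 1} \<subseteq> insert (?r (v + v + 1)) (insert (?r (v + v)) {?r v, ?r 1})"
      by blast
    from gens.weaken[OF vv1 this] show ?thesis by simp
  qed
qed simp

lemma gens_const:
  assumes "0 < h" "h < 2 ^ k" "0 < w" "w < 2 ^ l"
  shows "gens (2 * l + 2 * k) {mat h w (\<lambda>_ _. z)}"
proof -
  have "gens (2 * l) {mat 1 w (\<lambda>_ _. z)}"
    by (rule gens.weaken[OF gens_const_row[OF assms(3,4), of z]]) simp_all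
  from gens_const_column[OF this assms(1,2)] show ?thesis
    by (rule gens.weaken) simp_all
qed

section \<open>The spiral of binary counters\<close>

text \<open>\<open>u\<close> is the number of bits of the counter and \<open>2 ^ k\<close> the
  number of its shifted copies in a band.\<close>

locale spiral =
  fixes zero one mark :: 'a and u k :: nat
  assumes distinct: "zero \<noteq> one" "mark \<noteq> zero" "mark \<noteq> one"
begin

text \<open>Read downwards, column \<open>v\<close> is a mark followed by the binary digits of
  \<open>v\<close>, least significant first.\<close>

definition counter :: "nat \<Rightarrow> nat \<Rightarrow> 'a" where
  "counter b v = (if b = 0 then mark else if bit v (b - 1) then one else zero)"

text \<open>Row block \<open>r\<close> is the counter moved right by \<open>r\<close> columns and
  padded with zeros, so a column \<open>z\<close> that meets all copies spells \<open>z\<close>,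
  \<open>z - 1\<close>, \<open>z - 2\<close> and so on.\<close>

definition band :: "nat \<Rightarrow> nat \<Rightarrow> 'a" where
  "band i j = (let r = i div (u + 1) in
     if r \<le> j \<and> j < r + 2 ^ u then counter (i mod (u + 1)) (j - r) else zero)"

definition thickness :: nat where
  "thickness = 2 ^ k * (u + 1)"

text \<open>The last copy starts at column \<open>2 ^ k - 1\<close>; from column \<open>span\<close>
  on the band is zero.\<close>

definition span :: nat where
  "span = 2 ^ u + 2 ^ k - 1"

primrec spiral :: "nat \<Rightarrow> nat \<Rightarrow> nat \<Rightarrow> 'a" where
  "spiral 0 i j = zero"
| "spiral (Suc n) i j =
    (if i < thickness then band i j else if j < thickness then band j (i - thickness)
     else spiral n (i - thickness) (j - thickness))"

text \<open>A core of side \<open>span + thickness\<close> inside the layers gives every band room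
  for its full length, followed by a zero padding whose length is a positive multiple of
  \<open>thickness\<close>.\<close>

definition side :: "nat \<Rightarrow> nat" where
  "side n = n * thickness + span + thickness"

lemma thickness_pos: "thickness > 0"
  by (simp add: thickness_def)

lemma row_block: "i < thickness \<Longrightarrow> i div (u + 1) < 2 ^ k"
  unfolding thickness_def by (metis less_mult_imp_div_less)

lemma band_zero: "i < thickness \<Longrightarrow> j \<ge> span \<Longrightarrow> band i j = zero"
  using row_block[of i] unfolding band_def span_def Let_def by (auto simp del: One_nat_def)

text \<open>In this range of columns all \<open>2 ^ k\<close> shifted copies are present.\<close>

lemma band_counter:
  assumes "i < thickness" "2 ^ k \<le> z" "z < 2 ^ u"
  shows "band i z = counter (i mod (u + 1)) (z - i div (u + 1))"
  using row_block[OF assms(1)] assms(2,3) by (simp add: band_def Let_def)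

section \<open>A small SLP for the spiral\<close>

lemma bit_add_power:
  assumes "i < n"
  shows "bit (2 ^ n + j :: nat) i = bit j i"
proof -
  obtain d where "n = i + Suc d"
    using assms less_iff_Suc_add by auto
  then have "2 ^ n + j = j + (2 * 2 ^ d) * 2 ^ i"
    by (simp add: power_add)
  then show ?thesis
    by (simp add: bit_iff_odd del: mult.assoc)
qed

lemma bit_add_power_same: "j < 2 ^ n \<Longrightarrow> bit (2 ^ n + j :: nat) n"
  by (simp add: bit_iff_odd)

lemma bit_less_power: "j < 2 ^ n \<Longrightarrow> \<not> bit (j :: nat) n"
  by (simp add: bit_iff_odd)

text \<open>Doubling the range repeats the lower rows on both halves and adds a top-bit row of zeros
  followed by ones. The constant rows are carried along for that row; each bit costs five
  rules.\<close>

lemma gens_counter: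
  "gens (5 * n + 3) {mat (n + 1) (2 ^ n) counter, mat 1 (2 ^ n) (\<lambda>_ _. zero), mat 1 (2 ^ n) (\<lambda>_ _. one)}"
proof (induction n)
  case 0
  have "gens 3 {[[mark]], [[zero]], [[one]]}"
    using gens.chr[OF gens.chr[OF gens.chr[OF gens.empty]], of mark zero one]
    by (simp add: numeral_eq_Suc)
  then show ?case by (simp add: mat_def counter_def)
next
  case (Suc n)
  let ?z = "\<lambda>w. mat 1 w (\<lambda>_ _. zero)" and ?o = "\<lambda>w. mat 1 w (\<lambda>_ _. one)"
  let ?w = "2 ^ n :: nat"
  have 1: "gens (Suc (5 * n + 3)) (insert (?z (?w + ?w)) {mat (n + 1) ?w counter, ?z ?w, ?o ?w})"
    by (rule gens_hcat_mat[OF Suc.IH]) simp_all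
  have 2: "gens (Suc (Suc (5 * n + 3))) (insert (?o (?w + ?w))
      (insert (?z (?w + ?w)) {mat (n + 1) ?w counter, ?z ?w, ?o ?w}))"
    by (rule gens_hcat_mat[OF 1]) simp_all
  have 3: "gens (Suc (Suc (Suc (5 * n + 3)))) (insert (mat (n + 1) (?w + ?w) counter)
      (insert (?o (?w + ?w)) (insert (?z (?w + ?w)) {mat (n + 1) ?w counter, ?z ?w, ?o ?w})))"
    by (rule gens_hcat_mat[OF 2, of _ _ counter _ counter]) (simp_all add: counter_def bit_add_power)
  have 4: "gens (Suc (Suc (Suc (Suc (5 * n + 3))))) (insert (mat 1 (?w + ?w) (\<lambda>_. counter (n + 1)))
      (insert (mat (n + 1) (?w + ?w) counter)
      (insert (?o (?w + ?w)) (insert (?z (?w + ?w)) {mat (n + 1) ?w counter, ?z ?w, ?o ?w}))))"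
    by (rule gens_hcat_mat[OF 3, of _ _ "\<lambda>_ _. zero" _ "\<lambda>_ _. one"])
      (simp_all add: counter_def bit_add_power_same bit_less_power)
  have 5: "gens (Suc (Suc (Suc (Suc (Suc (5 * n + 3)))))) (insert (mat (n + 1 + 1) (?w + ?w) counter)
      (insert (mat 1 (?w + ?w) (\<lambda>_. counter (n + 1)))
      (insert (mat (n + 1) (?w + ?w) counter)
      (insert (?o (?w + ?w)) (insert (?z (?w + ?w)) {mat (n + 1) ?w counter, ?z ?w, ?o ?w})))))"
    by (rule gens_vcat_mat[OF 4]) simp_all
  have w: "2 ^ Suc n = ?w + ?w" by simp
  show ?case
    unfolding w by (rule gens.weaken[OF 5]) auto
qed

text \<open>Twice as many copies are obtained by stacking the band on itself, the lower one moved
  right by \<open>2 ^ n\<close>, both padded with \<open>2 ^ n\<close> zero columns. Each doubling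
  costs five rules, including those that double the zero block.\<close>

lemma gens_band_aux:
  "gens (7 * u + 7 + 5 * n) {mat (2 ^ n * (u + 1)) (2 ^ u + 2 ^ n - 1) band,
     mat (2 ^ n * (u + 1)) (2 ^ n) (\<lambda>_ _. zero)}"
proof (induction n)
  case 0
  have 1: "gens (5 * u + 3) {mat (u + 1) (2 ^ u) counter}"
    by (rule gens.weaken[OF gens_counter[of u]]) simp_all
  have "mat (u + 1) (2 ^ u) counter = mat (u + 1) (2 ^ u) band"
    by (rule mat_cong) (simp add: band_def)
  moreover have 2: "gens (2 * 1 + 2 * (u + 1)) {mat (u + 1) 1 (\<lambda>_ _. zero)}"
    by (rule gens_const) (simp_all add: less_exp flip: power_Suc)
  ultimately show ?case
    using gens_Un[OF 1 2] by (auto elim: gens.weaken)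
next
  case (Suc n)
  let ?h = "2 ^ n * (u + 1)" and ?v = "2 ^ n :: nat" and ?w = "2 ^ u + 2 ^ n - 1 :: nat"
  let ?z = "\<lambda>h w. mat h w (\<lambda>_ _. zero)"
  have blk: "i div (u + 1) < ?v" if "i < ?h" for i
    using that by (metis less_mult_imp_div_less)
  \<comment> \<open>Descending by \<open>2 ^ n\<close> row blocks keeps the row within its counter
    and increases the shift by \<open>2 ^ n\<close>.\<close>
  have shift: "(?h + i) div (u + 1) = ?v + i div (u + 1)" "(?h + i) mod (u + 1) = i mod (u + 1)" for i
    by (subst add.commute, subst div_mult_self1; simp) (subst add.commute, rule mod_mult_self1)
  have 1: "gens (Suc (7 * u + 7 + 5 * n)) (insert (?z ?h (?v + ?v)) {mat ?h ?w band, ?z ?h ?v})"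
    by (rule gens_hcat_mat[OF Suc.IH]) simp_all
  have 2: "gens (Suc (Suc (7 * u + 7 + 5 * n))) (insert (?z (?h + ?h) (?v + ?v))
      (insert (?z ?h (?v + ?v)) {mat ?h ?w band, ?z ?h ?v}))"
    by (rule gens_vcat_mat[OF 1]) simp_all
  have 3: "gens (Suc (Suc (Suc (7 * u + 7 + 5 * n)))) (insert (mat ?h (?w + ?v) band)
      (insert (?z (?h + ?h) (?v + ?v)) (insert (?z ?h (?v + ?v)) {mat ?h ?w band, ?z ?h ?v})))"
    by (rule gens_hcat_mat[OF 2, of _ _ band _ "\<lambda>_ _. zero"])
      (use blk in \<open>force simp: band_def Let_def\<close>)+
  have 4: "gens (Suc (Suc (Suc (Suc (7 * u + 7 + 5 * n)))))
      (insert (mat ?h (?v + ?w) (\<lambda>i. band (?h + i))) (insert (mat ?h (?w + ?v) band)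
      (insert (?z (?h + ?h) (?v + ?v)) (insert (?z ?h (?v + ?v)) {mat ?h ?w band, ?z ?h ?v}))))"
    by (rule gens_hcat_mat[OF 3, of _ _ "\<lambda>_ _. zero" _ band])
      (simp_all only: band_def Let_def shift, simp_all)
  have 5: "gens (Suc (Suc (Suc (Suc (Suc (7 * u + 7 + 5 * n))))))
      (insert (mat (?h + ?h) (?w + ?v) band)
      (insert (mat ?h (?v + ?w) (\<lambda>i. band (?h + i))) (insert (mat ?h (?w + ?v) band)
      (insert (?z (?h + ?h) (?v + ?v)) (insert (?z ?h (?v + ?v)) {mat ?h ?w band, ?z ?h ?v})))))"
    by (rule gens_vcat_mat[OF 4, of _ _ band _ "\<lambda>i. band (?h + i)"]) (simp_all add: add.commute)
  have eq: "2 ^ Suc n * (u + 1) = ?h + ?h" "2 ^ u + 2 ^ Suc n - 1 = ?w + ?v" "2 ^ Suc n = ?v + ?v"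
    by simp_all
  show ?case
    unfolding eq(1,2) unfolding eq(3) by (rule gens.weaken[OF 5]) auto
qed

lemma gens_band: "gens (7 * u + 7 + 5 * k) {mat thickness span band}"
  unfolding thickness_def span_def by (rule gens.weaken[OF gens_band_aux]) auto

text \<open>A layer costs six rules: two lengthen the zero paddings, two pad the bands, one puts the
  vertical band to the left of the inner spiral and one puts the horizontal band on top. The
  assumptions keep the cost of the base case linear in \<open>u\<close>.\<close>

lemma gens_spiral_aux:
  assumes "k \<le> u" "thickness \<le> 2 ^ u"
  shows "gens (32 * u + 26 + 6 * n) {mat thickness span band, mat span thickness (\<lambda>i j. band j i),
    mat thickness thickness (\<lambda>_ _. zero), mat thickness (Suc n * thickness) (\<lambda>_ _. zero),
    mat (Suc n * thickness) thickness (\<lambda>_ _. zero), mat (side n) (side n) (spiral n)}"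
proof (induction n)
  case 0
  have 1: "gens (12 * u + 7) {mat thickness span band}"
    by (rule gens.weaken[OF gens_band]) (use assms(1) in auto)
  have 2: "gens (12 * u + 7) {mat span thickness (\<lambda>i j. band j i)}"
    using gens_tr[OF 1] thickness_pos by (simp add: tr_mat)
  have 3: "gens (2 * (u + 1) + 2 * (u + 1)) {mat thickness thickness (\<lambda>_ _. zero)}"
    by (rule gens_const) (use thickness_pos assms(2) in auto)
  have "2 ^ k \<le> (2 ^ u :: nat)" using assms(1) by simp
  moreover have "2 ^ (u + 2) = 4 * (2 ^ u :: nat)" "(2 ^ u :: nat) > 0" by simp_all
  ultimately have "side 0 < 2 ^ (u + 2)"
    using assms(2) unfolding side_def span_def mult_0 by linarith
  then have 4: "gens (2 * (u + 2) + 2 * (u + 2)) {mat (side 0) (side 0) (\<lambda>_ _. zero)}"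
    by (intro gens_const) (use thickness_pos in \<open>auto simp: side_def\<close>)
  have "spiral 0 = (\<lambda>_ _. zero)" by (intro ext) simp
  with gens_Un[OF gens_Un[OF 1 2] gens_Un[OF 3 4]] show ?case
    by (elim gens.weaken) auto
next
  case (Suc n)
  let ?t = thickness and ?l = span and ?z = "\<lambda>h w. mat h w (\<lambda>_ _. zero)"
  let ?q = "Suc n * thickness" and ?N = "32 * u + 26 + 6 * n"
  let ?V = "\<lambda>i j. band j i"
  let ?F = "{mat ?t ?l band, mat ?l ?t ?V, ?z ?t ?t, ?z ?t ?q, ?z ?q ?t, mat (side n) (side n) (spiral n)}"
  have 1: "gens (Suc ?N) (insert (?z ?t (?q + ?t)) ?F)"
    by (rule gens_hcat_mat[OF Suc.IH]) simp_all
  have 2: "gens (Suc (Suc ?N)) (insert (?z (?q + ?t) ?t) (insert (?z ?t (?q + ?t)) ?F))"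
    by (rule gens_vcat_mat[OF 1]) simp_all
  have 3: "gens (Suc (Suc (Suc ?N))) (insert (mat ?t (?l + (?q + ?t)) band)
      (insert (?z (?q + ?t) ?t) (insert (?z ?t (?q + ?t)) ?F)))"
    by (rule gens_hcat_mat[OF 2, of _ _ band _ "\<lambda>_ _. zero"]) (simp_all add: band_zero)
  have 4: "gens (Suc (Suc (Suc (Suc ?N)))) (insert (mat (?l + ?q) ?t ?V)
      (insert (mat ?t (?l + (?q + ?t)) band)
      (insert (?z (?q + ?t) ?t) (insert (?z ?t (?q + ?t)) ?F))))"
    by (rule gens_vcat_mat[OF 3, of _ _ ?V _ "\<lambda>_ _. zero"]) (simp_all add: band_zero)
  have s: "side n = ?l + ?q" by (simp add: side_def)
  have 5: "gens (Suc (Suc (Suc (Suc (Suc ?N)))))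
      (insert (mat (side n) (?t + side n) (\<lambda>i. spiral (Suc n) (?t + i)))
      (insert (mat (?l + ?q) ?t ?V) (insert (mat ?t (?l + (?q + ?t)) band)
      (insert (?z (?q + ?t) ?t) (insert (?z ?t (?q + ?t)) ?F)))))"
    by (rule gens_hcat_mat[OF 4, of _ _ ?V _ "spiral n"]) (simp_all add: s)
  have s': "?l + (?q + ?t) = ?t + side n" by (simp add: side_def)
  have 6: "gens (Suc (Suc (Suc (Suc (Suc (Suc ?N))))))
      (insert (mat (?t + side n) (?t + side n) (spiral (Suc n)))
      (insert (mat (side n) (?t + side n) (\<lambda>i. spiral (Suc n) (?t + i)))
      (insert (mat (?l + ?q) ?t ?V) (insert (mat ?t (?l + (?q + ?t)) band)
      (insert (?z (?q + ?t) ?t) (insert (?z ?t (?q + ?t)) ?F))))))"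
    by (rule gens_vcat_mat[OF 5, of _ _ band _ "\<lambda>i. spiral (Suc n) (?t + i)"])
      (simp_all only: s'[symmetric], simp_all)
  have eq: "Suc (Suc n) * ?t = ?q + ?t" "side (Suc n) = ?t + side n"
    by (simp_all add: side_def)
  show ?case
    unfolding eq by (rule gens.weaken[OF 6]) (simp_all del: spiral.simps)
qed

lemma spiral_slp:
  assumes "k \<le> u" "thickness \<le> 2 ^ u"
  shows "\<exists>G. slp_derives G (mat (side n) (side n) (spiral n)) \<and> card (nts G) \<le> 32 * u + 26 + 6 * n"
  by (rule gens_slp[OF gens_spiral_aux[OF assms]]) simp

section \<open>Cross-sections of bands and the lower bound\<close>

lemma spiral_shift: "l \<le> n \<Longrightarrow> spiral n (l * thickness + i) (l * thickness + j) = spiral (n - l) i j"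
proof (induction l arbitrary: n)
  case (Suc l)
  then obtain n' where "n = Suc n'" "l \<le> n'"
    by (cases n) auto
  with Suc.IH[of n'] show ?case by (simp add: add.assoc)
qed simp

lemma spiral_row_band:
  assumes "l < n" "i < thickness"
  shows "spiral n (l * thickness + i) (l * thickness + z) = band i z"
proof -
  obtain n' where "n - l = Suc n'"
    using assms(1) by (metis Suc_diff_Suc)
  with spiral_shift[of l n i z] assms show ?thesis by simp
qed

text \<open>The extra \<open>thickness\<close> appears because the vertical band of a layer starts
  below its horizontal band.\<close>

lemma spiral_column_band:
  assumes "l < n" "i < thickness"
  shows "spiral n (l * thickness + (thickness + z)) (l * thickness + i) = band i z"
proof -
  obtain n' where "n - l = Suc n'"
    using assms(1) by (metis Suc_diff_Suc)
  with spiral_shift[of l n "thickness + z" i] assms show ?thesis by simp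
qed

lemma counter_eq_mark: "counter b v = mark \<longleftrightarrow> b = 0"
  using distinct by (auto simp: counter_def)

lemma counter_inj:
  assumes "v < 2 ^ u" "w < 2 ^ u" "\<And>b. 0 < b \<Longrightarrow> b \<le> u \<Longrightarrow> counter b v = counter b w"
  shows "v = w"
proof -
  have "bit v i = bit w i" if "i < u" for i
    using assms(3)[of "Suc i"] that distinct(1) by (auto simp: counter_def split: if_splits)
  then have "take_bit u v = take_bit u w"
    by (auto simp: bit_eq_iff bit_take_bit_iff)
  with assms(1,2) show ?thesis by (simp add: take_bit_nat_eq_self)
qed

text \<open>The marks reveal the offset of a window modulo \<^term>\<open>u + 1\<close>, and the full counter value
  inside it reveals its row block.\<close>
lemma window_position:
  assumes z: "2 ^ k \<le> z" "z < 2 ^ u"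
    and i: "i + 2 * (u + 1) \<le> thickness" "i' + 2 * (u + 1) \<le> thickness"
    and eq: "\<And>d. d < 2 * (u + 1) \<Longrightarrow> band (i + d) z = band (i' + d) z"
  shows "i = i'"
proof -
  \<comment> \<open>\<open>d\<close> is the distance from \<open>i\<close> to the next multiple of
    \<open>u + 1\<close>, where a mark stands. It is at most \<open>u\<close>, so a complete counter
    value follows within the window.\<close>
  define d where "d = u - (i + u) mod (u + 1)"
  have d: "d \<le> u" by (simp add: d_def)
  have "(i + u) mod (u + 1) \<le> u"
    using mod_less_divisor[of "u + 1" "i + u"] by linarith
  then have "i + d + (i + u) mod (u + 1) = i + u"
    by (simp add: d_def)
  then have "i + d = (i + u) div (u + 1) * (u + 1)"
    by (metis add_right_cancel div_mult_mod_eq)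
  then obtain q where q: "i + d = q * (u + 1)" by blast
  have bi: "band (i + e) z = counter ((i + e) mod (u + 1)) (z - (i + e) div (u + 1))"
    "band (i' + e) z = counter ((i' + e) mod (u + 1)) (z - (i' + e) div (u + 1))"
    if "e < 2 * (u + 1)" for e
    using that i z by (intro band_counter; linarith)+
  have "band (i + d) z = mark"
    using bi(1)[of d] d unfolding q mod_mult_self2_is_0 counter_eq_mark[symmetric]
    by (simp add: counter_def)
  then have "counter ((i' + d) mod (u + 1)) (z - (i' + d) div (u + 1)) = mark"
    using bi(2)[of d] eq[of d] d by simp
  then obtain q' where q': "i' + d = q' * (u + 1)"
    using counter_eq_mark by (metis dvd_div_mult_self mod_0_imp_dvd)
  have "i + d < thickness" "i' + d < thickness"
    using i d by simp_all
  then have lt: "q < 2 ^ k" "q' < 2 ^ k"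
    unfolding q q' thickness_def by (simp_all only: mult_less_cancel2)
  have "z - q = z - q'"
  proof (rule counter_inj)
    fix b assume b: "0 < b" "b \<le> u"
    have *: "(p * (u + 1) + b) mod (u + 1) = b" "(p * (u + 1) + b) div (u + 1) = p" for p
      using b by (simp_all only: mod_mult_self3 div_mult_self3, simp_all)
    have "i + (d + b) = q * (u + 1) + b" "i' + (d + b) = q' * (u + 1) + b"
      using q q' by simp_all
    moreover have "d + b < 2 * (u + 1)" using d b by simp
    ultimately show "counter b (z - q) = counter b (z - q')"
      using bi[of "d + b"] eq[of "d + b"] * by metis
  qed (use z in auto)
  \<comment> \<open>As \<open>q\<close> and \<open>q'\<close> are below
    \<open>2 ^ k \<le> z\<close>, neither subtraction is truncated.\<close>
  with lt z have "q = q'" by simp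
  with q q' show ?thesis by simp
qed

text \<open>By \<open>window_position\<close>, windows lying inside the cross-section at different
  positions are different; the bound counts these positions.\<close>

lemma card_windows_ge:
  assumes z: "2 ^ k \<le> z" "z < 2 ^ u"
    and F: "p + thickness \<le> length F" "\<And>i. i < thickness \<Longrightarrow> F ! (p + i) = band i z"
  shows "thickness + 1 - 2 * (u + 1) \<le>
    card ((\<lambda>i. take (2 * (u + 1)) (drop i F)) ` {i. i + 2 * (u + 1) \<le> length F})"
proof -
  let ?L = "2 * (u + 1)"
  define w where "w i = take ?L (drop (p + i) F)" for i
  define I where "I = {..<thickness + 1 - ?L}"
  have I: "i + ?L \<le> thickness" if "i \<in> I" for i
    using that by (auto simp: I_def)
  have "inj_on w I"
  proof (rule inj_onI)
    fix i i' assume ii: "i \<in> I" "i' \<in> I" "w i = w i'"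
    have nth: "w i ! d = band (i + d) z" if "i \<in> I" "d < ?L" for i d
      using that I[OF that(1)] F(1) F(2)[of "i + d"] by (simp add: w_def add.assoc)
    show "i = i'"
      using window_position[OF z I[OF ii(1)] I[OF ii(2)]] nth ii by metis
  qed
  then have "card I = card (w ` I)"
    by (simp add: card_image)
  also have "\<dots> \<le> card ((\<lambda>i. take ?L (drop i F)) ` {i. i + ?L \<le> length F})"
  proof (rule card_mono)
    have "{i. i + ?L \<le> length F} \<subseteq> {..length F}" by auto
    then show "finite ((\<lambda>i. take ?L (drop i F)) ` {i. i + ?L \<le> length F})"
      by (meson finite_atMost finite_imageI finite_subset)
    show "w ` I \<subseteq> (\<lambda>i. take ?L (drop i F)) ` {i. i + ?L \<le> length F}"
      unfolding w_def using I F(1) by fastforce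
  qed
  finally show ?thesis by (simp add: I_def)
qed

text \<open>The range of \<open>z\<close> is the one where a line across the band meets every copy
  of the counter; \<open>p\<close> is where this cross-section starts in \<open>F\<close>.\<close>

definition crosses_band :: "'a list \<Rightarrow> bool" where
  "crosses_band F \<longleftrightarrow> (\<exists>p z. 2 ^ k \<le> z \<and> z < 2 ^ u \<and> p + thickness \<le> length F \<and>
     (\<forall>i<thickness. F ! (p + i) = band i z))"

text \<open>The invariant: a rectangle with upper left corner \<^term>\<open>(r, c)\<close> contains
  \<^term>\<open>{l * thickness..<m * thickness} \<times> {l * thickness..<m * thickness}\<close>. A cut through this square
  either removes at most two layers from it, or it crosses a band of the \<^term>\<open>l\<close>-th layer.\<close>
lemma shallow_crosses_band:
  assumes closed: "\<And>X Y. X \<in> nts G \<Longrightarrow> Y \<in> rhs_syms (rules G X) \<Longrightarrow> Y \<in> nts G"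
    and m: "m * thickness \<le> 2 ^ u"
    and "derives G X A" "slp_depth G X d" "X \<in> nts G"
    and "\<And>i j. i < length A \<Longrightarrow> j < length (hd A) \<Longrightarrow> A ! i ! j = spiral m (r + i) (c + j)"
    and "r \<le> l * thickness" "c \<le> l * thickness"
    and "m * thickness \<le> r + length A" "m * thickness \<le> c + length (hd A)"
    and "l + 2 * d \<le> m"
  shows "\<exists>Y\<in>nts G. \<exists>B. derives G Y B \<and> (crosses_band (map hd B) \<or> crosses_band (hd B))"
  using assms(3-)
proof (induction arbitrary: d r c l rule: derives.induct)
  case (chr X a)
  from chr.prems(1) have "d = 1"
    by cases (use chr.hyps in auto)
  \<comment> \<open>At depth 1 the square still has at least two layers, too many for a single
    cell.\<close>
  with chr.prems(8) have "(l + 2) * thickness \<le> m * thickness"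
    by (intro mult_le_mono1) simp
  moreover have "m * thickness \<le> l * thickness + 1"
    using chr.prems(4,6) by simp
  ultimately show ?case using thickness_pos by (simp add: add_mult_distrib)
next
  case (hcat X Y Z A B)
  note rect = derives_rectangular(1,2)[OF hcat.hyps(2)] derives_rectangular(1,2)[OF hcat.hyps(3)]
  obtain d1 d2 where d: "d = Suc (max d1 d2)" "slp_depth G Y d1" "slp_depth G Z d2"
    using hcat.prems(1) by cases (use hcat.hyps(1) in auto)
  have mem: "Y \<in> nts G" "Z \<in> nts G"
    using closed[OF hcat.prems(2)] hcat.hyps(1) by auto
  define x where "x = c + length (hd A)"
  have len: "length (map2 (@) A B) = length A"
    "length (hd (map2 (@) A B)) = length (hd A) + length (hd B)"
    using hcat.hyps(4) rect by (simp_all add: hd_map hd_zip)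
  have entry: "(A ! i @ B ! i) ! j = spiral m (r + i) (c + j)"
    if "i < length A" "j < length (hd A) + length (hd B)" for i j
    using hcat.prems(3)[of i j] that len hcat.hyps(4) by simp
  have left: "A ! i ! j = spiral m (r + i) (c + j)" if "i < length A" "j < length (hd A)" for i j
    using entry[of i j] that derives_nth_length[OF hcat.hyps(2)] by (simp add: nth_append)
  have right: "B ! i ! j = spiral m (r + i) (x + j)" if "i < length B" "j < length (hd B)" for i j
    using entry[of i "length (hd A) + j"] that derives_nth_length[OF hcat.hyps(2)] hcat.hyps(4)
    by (simp add: nth_append x_def add.assoc)
  \<comment> \<open>A cut beyond the square leads to the left child with the same \<open>l\<close>.
    A cut before the end of the first two layers leads to the right child with \<open>l + 2\<close>,
    paid for by the lost level of depth. Any other cut meets the horizontal band of layer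
    \<open>l\<close>.\<close>
  consider "m * thickness \<le> x" | "x \<le> (l + 2) * thickness"
    | "(l + 2) * thickness < x" "x < m * thickness"
    by linarith
  then show ?case
  proof cases
    case 1
    show ?thesis
      by (rule hcat.IH(1)[OF d(2) mem(1) left hcat.prems(4,5)])
        (use 1 hcat.prems(6,8) len d(1) in \<open>auto simp: x_def\<close>)
  next
    case 2
    show ?thesis
      by (rule hcat.IH(2)[OF d(3) mem(2) right _ 2])
        (use hcat.prems(4,6-8) hcat.hyps(4) len d(1) in \<open>auto simp: x_def add_mult_distrib\<close>)
  next
    case 3
    have "l < m" using hcat.prems(8) d(1) by simp
    then have lm: "l * thickness + thickness \<le> m * thickness"
      using mult_le_mono1[of "Suc l" m thickness] by simp
    define p where "p = l * thickness - r"
    define z where "z = x - l * thickness"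
    have pz: "r + p = l * thickness" "x = l * thickness + z"
      using 3(1) hcat.prems(4) by (simp_all add: p_def z_def add_mult_distrib)
    \<comment> \<open>The right child is used because the cut runs along its first column, the one
      that the window count can see.\<close>
    have "crosses_band (map hd B)"
      unfolding crosses_band_def
    proof (intro exI conjI allI impI)
      have "2 ^ k \<le> thickness" by (simp add: thickness_def)
      with 3(1) pz show "2 ^ k \<le> z" by (simp add: add_mult_distrib)
      show "z < 2 ^ u" using 3(2) pz m by linarith
      show len_B: "p + thickness \<le> length (map hd B)"
        using hcat.prems(6) lm pz len hcat.hyps(4) by simp
      fix i assume i: "i < thickness"
      then have "p + i < length B" using len_B by simp
      moreover from this have "B ! (p + i) \<noteq> []"
        using derives_nth_length[OF hcat.hyps(3)] rect(4) by (metis length_0_conv)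
      ultimately have "map hd B ! (p + i) = B ! (p + i) ! 0"
        by (simp add: hd_conv_nth)
      also have "\<dots> = spiral m (r + (p + i)) (x + 0)"
        using right[of "p + i" 0] \<open>p + i < length B\<close> rect(4) by simp
      also have "\<dots> = band i z"
        using spiral_row_band[OF \<open>l < m\<close> i, of z] pz by (simp flip: add.assoc)
      finally show "map hd B ! (p + i) = band i z" .
    qed
    with mem hcat.hyps(3) show ?thesis by blast
  qed
next
  case (vcat X Y Z A B)
  note rect = derives_rectangular(1,2)[OF vcat.hyps(2)] derives_rectangular(1,2)[OF vcat.hyps(3)]
  obtain d1 d2 where d: "d = Suc (max d1 d2)" "slp_depth G Y d1" "slp_depth G Z d2"
    using vcat.prems(1) by cases (use vcat.hyps(1) in auto)
  have mem: "Y \<in> nts G" "Z \<in> nts G"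
    using closed[OF vcat.prems(2)] vcat.hyps(1) by auto
  define y where "y = r + length A"
  have len: "length (A @ B) = length A + length B" "length (hd (A @ B)) = length (hd A)"
    using rect by simp_all
  have above: "A ! i ! j = spiral m (r + i) (c + j)" if "i < length A" "j < length (hd A)" for i j
    using vcat.prems(3)[of i j] that len by (simp add: nth_append)
  have below: "B ! i ! j = spiral m (y + i) (c + j)" if "i < length B" "j < length (hd B)" for i j
    using vcat.prems(3)[of "length A + i" j] that len vcat.hyps(4)
    by (simp add: nth_append y_def add.assoc)
  consider "m * thickness \<le> y" | "y \<le> (l + 2) * thickness"
    | "(l + 2) * thickness < y" "y < m * thickness"
    by linarith
  then show ?case
  proof cases
    case 1
    show ?thesis
      by (rule vcat.IH(1)[OF d(2) mem(1) above vcat.prems(4,5)])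
        (use 1 vcat.prems(7,8) len d(1) in \<open>auto simp: y_def\<close>)
  next
    case 2
    show ?thesis
      by (rule vcat.IH(2)[OF d(3) mem(2) below 2])
        (use vcat.prems(5-8) vcat.hyps(4) len d(1) in \<open>auto simp: y_def add_mult_distrib\<close>)
  next
    case 3
    have "l < m" using vcat.prems(8) d(1) by simp
    then have lm: "l * thickness + thickness \<le> m * thickness"
      using mult_le_mono1[of "Suc l" m thickness] by simp
    define p where "p = l * thickness - c"
    \<comment> \<open>The vertical band starts one \<open>thickness\<close> below the corner of its
      layer. Skipping two layers still leaves \<open>z > thickness\<close>, hence
      \<open>z \<ge> 2 ^ k\<close>.\<close>
    define z where "z = y - (l * thickness + thickness)"
    have pz: "c + p = l * thickness" "y = l * thickness + (thickness + z)"
      using 3(1) vcat.prems(5) by (simp_all add: p_def z_def add_mult_distrib)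
    have "crosses_band (hd B)"
      unfolding crosses_band_def
    proof (intro exI conjI allI impI)
      have "2 ^ k \<le> thickness" by (simp add: thickness_def)
      with 3(1) pz show "2 ^ k \<le> z" by (simp add: add_mult_distrib)
      show "z < 2 ^ u" using 3(2) pz m by linarith
      show len_B: "p + thickness \<le> length (hd B)"
        using vcat.prems(7) lm pz len vcat.hyps(4) by simp
      fix i assume i: "i < thickness"
      have "hd B ! (p + i) = B ! 0 ! (p + i)"
        using rect(3) by (simp add: hd_conv_nth)
      also have "\<dots> = spiral m (y + 0) (c + (p + i))"
        using below[of 0 "p + i"] i len_B rect(3) by simp
      also have "\<dots> = band i z"
        using spiral_column_band[OF \<open>l < m\<close> i, of z] pz by (simp flip: add.assoc)
      finally show "hd B ! (p + i) = band i z" .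
    qed
    with mem vcat.hyps(3) show ?thesis by blast
  qed
qed

text \<open>The invariant starts with the whole array and \<open>l = 0\<close>, and each level of
  depth may spend two of the \<open>m\<close> layers. So some nonterminal crosses a band, and the
  lower and upper bounds on its windows are compared.\<close>

lemma card_nts_ge:
  assumes m: "m * thickness \<le> 2 ^ u"
    and G: "slp_derives G (mat (side m) (side m) (spiral m))" "2 * depth G \<le> m"
  shows "2 ^ k \<le> 4 * card (nts G)"
proof -
  let ?L = "2 * (u + 1)"
  have slp: "is_slp2 G" and start: "start G \<in> nts G" "finite (nts G)"
    using G(1) by (auto simp: slp_derives_def is_slp2_def)
  have pos: "side m > 0" using thickness_pos by (simp add: side_def)
  have "\<exists>Y\<in>nts G. \<exists>B. derives G Y B \<and> (crosses_band (map hd B) \<or> crosses_band (hd B))"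
  proof (rule shallow_crosses_band[OF _ m])
    show "derives G (start G) (mat (side m) (side m) (spiral m))"
      using G(1) by (simp add: slp_derives_def)
    show "slp_depth G (start G) (depth G)"
      by (rule slp_depth_depth[OF G(1)])
    show "Y \<in> nts G" if "X \<in> nts G" "Y \<in> rhs_syms (rules G X)" for X Y
      using that slp unfolding is_slp2_def by blast
    show "0 + 2 * depth G \<le> m" using G(2) by simp
  qed (use start pos in \<open>auto simp: side_def\<close>)
  then obtain Y B where Y: "Y \<in> nts G" "derives G Y B"
    "crosses_band (map hd B) \<or> crosses_band (hd B)"
    by blast
  have "thickness + 1 - ?L \<le> card (nts G) * ?L"
    using Y(3)
  proof
    assume "crosses_band (map hd B)"
    then show ?thesis
      using card_windows_ge[of _ _ "map hd B"] card_windows_first_column[OF slp Y(1,2), of ?L]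
      unfolding crosses_band_def by fastforce
  next
    assume "crosses_band (hd B)"
    then show ?thesis
      using card_windows_ge[of _ _ "hd B"] card_windows_first_row[OF slp Y(1,2), of ?L]
      unfolding crosses_band_def by fastforce
  qed
  \<comment> \<open>Cancelling \<open>u + 1\<close> leaves
    \<open>2 ^ k \<le> 2 * card (nts G) + 2\<close>; the additive 2 is absorbed because the start
    symbol makes the cardinality positive.\<close>
  then have "2 ^ k * (u + 1) \<le> (2 * (card (nts G) + 1)) * (u + 1)"
    by (simp add: thickness_def algebra_simps)
  then have "2 ^ k \<le> 2 * (card (nts G) + 1)"
    by (simp only: mult_le_cancel2)
  moreover have "card (nts G) > 0"
    using start by (auto simp: card_gt_0_iff)
  moreover have "a \<le> 2 * (c + 1) \<Longrightarrow> c > 0 \<Longrightarrow> a \<le> 4 * c" for a c :: nat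
    by simp
  ultimately show ?thesis by blast
qed

end

section \<open>Choice of the parameters and the final estimate\<close>

lemma ex_three_distinct:
  assumes "card (UNIV :: 'a set) \<ge> 3"
  obtains x y z :: 'a where "x \<noteq> y" "z \<noteq> x" "z \<noteq> y"
proof -
  obtain A :: "'a set" where "card A = 3"
    using assms by (meson obtain_subset_with_card_n)
  then show thesis using that by (auto simp: card_3_iff)
qed

theorem mainTheorem10:
  fixes c :: int and \<Sigma> :: "'a::finite itself"
  assumes "card (UNIV :: 'a set) \<ge> 3"
    and "c \<ge> 1"
  shows "\<exists>\<alpha>::real. \<alpha> > 0 \<and>
    infinite {N::nat. \<exists>(S :: 'a list list) (G :: 'a slp2).
       is_2d S N N \<and> slp_derives G S \<and>
       (\<forall>G' :: 'a slp2. slp_derives G' S \<longrightarrow>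
          real (depth G') \<ge> real_of_int c * log 2 (real N) \<or>
          real (card (nts G')) \<ge> \<alpha> * real (card (nts G)) * real N / (log 2 (real N)) ^ 3)}"
proof -
  obtain zero one mark :: 'a where distinct: "zero \<noteq> one" "mark \<noteq> zero" "mark \<noteq> one"
    using ex_three_distinct[OF assms(1)] by metis
  \<comment> \<open>The aim is \<open>4 * c \<le> 2 ^ b\<close>: bounding \<open>4 * c\<close> by a
    power of two lets the layers fill exactly \<open>2 ^ u\<close> columns later.\<close>
  define b where "b = nat (4 * c)"
  have "real b = 4 * real_of_int c"
    using assms(2) by (simp add: b_def)
  moreover have "real b < 2 ^ b"
    by (rule of_nat_less_two_power)
  ultimately have b: "4 * real_of_int c \<le> 2 ^ b" by simp
  \<comment> \<open>\<open>608 = 38 * 4 * 4\<close> collects the bounds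
    \<open>card (nts G) \<le> 38 * m\<close>, \<open>N \<le> 4 * 2 ^ u\<close> and
    \<open>2 ^ k \<le> 4 * card (nts G')\<close>. The factor \<open>4 ^ b\<close> is the square of
    the factor \<open>2 ^ b\<close> of \<open>m\<close>, which enters once through
    \<open>card (nts G)\<close> and once through \<open>N\<close>.\<close>
  define \<alpha> :: real where "\<alpha> = 1 / (608 * 4 ^ b)"
  let ?good = "\<lambda>N. \<exists>(S :: 'a list list) (G :: 'a slp2).
       is_2d S N N \<and> slp_derives G S \<and>
       (\<forall>G' :: 'a slp2. slp_derives G' S \<longrightarrow>
          real (depth G') \<ge> real_of_int c * log 2 (real N) \<or>
          real (card (nts G')) \<ge> \<alpha> * real (card (nts G)) * real N / (log 2 (real N)) ^ 3)"
  have "\<exists>N>n. ?good N" for n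
  proof -
    \<comment> \<open>With \<open>u + 1 = 2 ^ e\<close> every factor of \<open>m * thickness\<close>
      is a power of two. The summand 4 gives \<open>4 * e \<le> 2 ^ e\<close>, hence room for
      \<open>k\<close>, and \<open>n\<close> makes \<open>N\<close> unbounded.\<close>
    define e where "e = n + b + 4"
    define u :: nat where "u = 2 ^ e - 1"
    have u1: "u + 1 = 2 ^ e" by (simp add: u_def)
    have "4 * e \<le> 2 ^ e"
    proof -
      have "4 * (4 + i) \<le> 2 ^ (4 + i)" for i :: nat
        by (induction i) (simp_all add: power_add)
      from this[of "n + b"] show ?thesis by (simp add: e_def algebra_simps)
    qed
    then have small: "2 * e + b \<le> u" "n < u"
      using u1 by (simp_all add: e_def)
    \<comment> \<open>This \<open>k\<close> solves \<open>m * thickness = 2 ^ u\<close>, so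
      \<open>2 ^ k\<close> is \<open>2 ^ u\<close> divided by \<open>2 ^ b * (u + 1) ^ 2\<close>, of
      the order of \<open>N / log^2 N\<close>.\<close>
    define k where "k = u - (2 * e + b)"
    define m where "m = 2 ^ b * (u + 1)"
    interpret spiral zero one mark u k
      by unfold_locales (use distinct in auto)
    have m: "m * thickness = 2 ^ u"
    proof -
      have "m * thickness = 2 ^ (b + e + (k + e))"
        unfolding m_def thickness_def u1 power_add by (simp only: ac_simps)
      also have "b + e + (k + e) = u" using small(1) by (simp add: k_def)
      finally show ?thesis .
    qed
    define N where "N = side m"
    have "m > 0" by (simp add: m_def)
    then have t: "thickness \<le> 2 ^ u" using m by (metis One_nat_def Suc_leI mult_1 mult_le_mono1)
    have ku: "k \<le> u" by (simp add: k_def)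
    have pow: "(2 ^ k :: nat) \<le> 2 ^ u" "(2 ^ k :: nat) > 0"
      by (simp_all add: k_def)
    have "N = 2 ^ u + (2 ^ u + 2 ^ k - 1) + thickness"
      using m by (simp add: N_def side_def span_def)
    then have N: "2 * 2 ^ u \<le> N" "N \<le> 4 * 2 ^ u"
      using t pow by arith+
    have "u < 2 ^ u" by (rule less_exp)
    with N small have "N > n" by linarith
    have Npos: "real N > 0" using \<open>N > n\<close> by simp
    have logN: "real (u + 1) \<le> log 2 (real N)" "log 2 (real N) \<le> real (u + 2)"
    proof -
      have "2 ^ (u + 1) \<le> real N" "real N \<le> 2 ^ (u + 2)"
        using N by (simp_all flip: of_nat_le_iff[where ?'a = real])
      then show "real (u + 1) \<le> log 2 (real N)" "log 2 (real N) \<le> real (u + 2)"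
        using le_log_of_power[of 2 "u + 1" "real N"] log_of_power_le[of N 2 "u + 2"] Npos
        by (simp_all del: power_Suc power_add)
    qed
    obtain G :: "'a slp2" where G: "slp_derives G (mat N N (spiral m))"
      "card (nts G) \<le> 32 * u + 26 + 6 * m"
      using spiral_slp[OF ku t, of m] unfolding N_def by blast
    have "real (card (nts G')) \<ge> \<alpha> * real (card (nts G)) * real N / (log 2 (real N)) ^ 3"
      if G': "slp_derives G' (mat N N (spiral m))"
        and shallow: "\<not> real (depth G') \<ge> real_of_int c * log 2 (real N)" for G' :: "'a slp2"
    proof -
      from shallow have "2 * real (depth G') < 2 * (real_of_int c * log 2 (real N))"
        by simp
      \<comment> \<open>Uses \<open>u + 2 \<le> 2 * (u + 1)\<close>. The chain shows that depth
        below \<open>c * log N\<close> fits into the \<open>m\<close> layers at two per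
        level.\<close>
      also have "\<dots> \<le> 2 * (real_of_int c * (2 * real (u + 1)))"
        using logN(2) assms(2) by (intro mult_left_mono) auto
      also have "\<dots> = 4 * real_of_int c * real (u + 1)" by simp
      also have "\<dots> \<le> 2 ^ b * real (u + 1)"
        using b by (rule mult_right_mono) simp
      also have "\<dots> = real m" by (simp add: m_def distrib_left)
      finally have "2 * depth G' \<le> m" by linarith
      then have "2 ^ k \<le> 4 * card (nts G')"
        using card_nts_ge[of m G'] m G' unfolding N_def by simp
      then have low: "real (2 ^ k) \<le> 4 * real (card (nts G'))"
        by (metis of_nat_le_iff of_nat_mult of_nat_numeral)
      have "card (nts G) \<le> 38 * m"
      proof -
        have "u + 1 \<le> m"
          using mult_le_mono1[of 1 "2 ^ b" "u + 1"] by (simp add: m_def)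
        then show ?thesis using G(2) by linarith
      qed
      then have "\<alpha> * real (card (nts G)) * real N \<le> \<alpha> * real (38 * m) * real (4 * 2 ^ u)"
        using N(2) by (intro mult_mono mult_left_mono) (auto simp: \<alpha>_def simp del: of_nat_mult)
      also have "\<dots> = \<alpha> * real (38 * m) * real (4 * (m * thickness))"
        by (simp only: m)
      \<comment> \<open>One factor \<open>u + 1\<close> comes from the size of \<open>G\<close> and
        two from \<open>m * thickness\<close>; together they form the cube of the logarithm.\<close>
      also have "\<dots> = real (2 ^ k) / 4 * real (u + 1) ^ 3"
      proof -
        have four: "(4 :: real) ^ b = 2 ^ b * 2 ^ b"
          by (simp flip: power_mult_distrib)
        have "real m = 2 ^ b * real (u + 1)" "real thickness = 2 ^ k * real (u + 1)"
          by (simp_all only: m_def thickness_def of_nat_mult of_nat_power of_nat_numeral)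
        then show ?thesis
          unfolding \<alpha>_def four of_nat_mult by (simp add: power3_eq_cube)
      qed
      also have "\<dots> \<le> real (card (nts G')) * log 2 (real N) ^ 3"
        using low logN(1) by (intro mult_mono power_mono) auto
      finally show "real (card (nts G')) \<ge> \<alpha> * real (card (nts G)) * real N / (log 2 (real N)) ^ 3"
        using logN(1) by (subst pos_divide_le_eq) auto
    qed
    with G(1) have "?good N" using is_2d_mat by blast
    with \<open>N > n\<close> show ?thesis by blast
  qed
  then have "infinite {N. ?good N}"
    unfolding infinite_nat_iff_unbounded by simp
  moreover have "\<alpha> > 0" by (simp add: \<alpha>_def)
  ultimately show ?thesis by blast
qed

end
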